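(* Let $L=\Delta+\mathbf{e}_3\cdot\nabla=\partial_2^2+\partial_3^2+\partial_3$ be the drift Laplacian on $\mathbb{R}^2$. There exists a numerical constant $K$ such that for any $u:S^+_\rho(p)\to\mathbb{R}$, where $S^+_\rho(p)$ is an upward sausage of arbitrary width $\rho>0$, the following gradient estimate holds: $$|\nabla u|(p)\le K\left(\frac1\rho\|u\|_{L^\infty(S^+_\rho(p))}+\rho\,\|Lu\|_{L^\infty(S^+_\rho(p))}\right).$$ For $p\in\Omega$ a general domain, with $\rho:=\operatorname{dist}(p,\partial\Omega)$: $$|\nabla u|(p)\le K\left(\rho^{-\frac12}\|u\|_{L^\infty(B_\rho(p))}+\rho^{\frac12}\|Lu\|_{L^\infty(B_\rho(p))}\right).$$ For $p\in\Omega$ a domain satisfying the upward sausages property, with $\rho:=\operatorname{dist}(p,\partial\Omega)$, the stronger estimate holds: $$|\nabla u|(p)\le K\left(\frac1\rho\|u\|_{L^\infty(B_\rho(p))}+\rho\,\|Lu\|_{L^\infty(B_\rho(p))}\right).$$ In particular, bounded $L$-harmonic functions $u$ (i.e. $Lu=0$) in general satisfy $|\partial_2u|(p)\le K\rho^{-\frac12}\|u\|_\infty$, where the exponent $-\tfrac12$ on $\rho$ is sharp.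
   Context: Coordinates on $\mathbb{R}^2$ are $(x_2,x_3)$, $\partial_i=\partial/\partial x_i$, and $\mathbf{e}_3=(0,1)$. $B_\rho(p)$ is the Euclidean ball of radius $\rho$ centered at $p$. The upward sausage of width $\rho>0$ at $p$ is $S^+_\rho(p)=\bigcup_{t\in[0,\rho^2)}(B_\rho(p)+t\,\mathbf{e}_3)$. In the second and third estimates and in the final statement, $\Omega\subseteq\mathbb{R}^2$ is an open domain and $u$ is a function on $\Omega$. An open domain $\Omega$ has the upward sausages property if either $\partial\Omega=\emptyset$ or, when $\partial\Omega\ne\emptyset$, for every $p\in\Omega$ one has $S^+_\rho(p)\subseteq\Omega$ with $\rho:=\operatorname{dist}(p,\partial\Omega)$. Functions $u$ are assumed regular enough (e.g. $C^2$) for $Lu$ to be defined.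
   Formalization: As printed the last three claims fail (ρ→0: u=x₂ on B_ρ; ρ→∞: third). Proved: second estimate for ρ≥1, with weights 1/ρ, ρ if ρ<1; third with norms over S⁺_ρ(p) instead of B_ρ(p); the bound on ∂₂u and sharpness of −1/2 for ρ≥1. *)

theory Defs
  imports "HOL-Analysis.Analysis" "HOL-Probability.Essential_Supremum"
begin

text \<open>Points of the plane are pairs \<open>(x2, x3)\<close>. The functions below are total, but on an open set
  \<open>S\<close> all the derivatives depend only on the restriction to \<open>S\<close>.\<close>

definition e3 :: "real \<times> real" where
  "e3 = (0, 1)"

definition pd2 :: "(real \<times> real \<Rightarrow> real) \<Rightarrow> real \<times> real \<Rightarrow> real" where
  "pd2 u x = deriv (\<lambda>s. u (s, snd x)) (fst x)"

definition pd3 :: "(real \<times> real \<Rightarrow> real) \<Rightarrow> real \<times> real \<Rightarrow> real" where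
  "pd3 u x = deriv (\<lambda>t. u (fst x, t)) (snd x)"

definition gradient :: "(real \<times> real \<Rightarrow> real) \<Rightarrow> real \<times> real \<Rightarrow> real \<times> real" where
  "gradient u x = (pd2 u x, pd3 u x)"

definition laplacian :: "(real \<times> real \<Rightarrow> real) \<Rightarrow> real \<times> real \<Rightarrow> real" where
  "laplacian u x = pd2 (pd2 u) x + pd3 (pd3 u) x"

definition drift_laplacian :: "(real \<times> real \<Rightarrow> real) \<Rightarrow> real \<times> real \<Rightarrow> real" where
  "drift_laplacian u x = laplacian u x + e3 \<bullet> gradient u x"

text \<open>Used for open \<open>S\<close> only, where these are the classical spaces \<open>C^1(S)\<close> and \<open>C^2(S)\<close>.\<close>

definition C1_on :: "(real \<times> real) set \<Rightarrow> (real \<times> real \<Rightarrow> real) \<Rightarrow> bool" where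
  "C1_on S u \<longleftrightarrow>
     (\<forall>x\<in>S. (\<lambda>s. u (s, snd x)) differentiable (at (fst x)) \<and>
            (\<lambda>t. u (fst x, t)) differentiable (at (snd x))) \<and>
     continuous_on S (pd2 u) \<and> continuous_on S (pd3 u)"

definition C2_on :: "(real \<times> real) set \<Rightarrow> (real \<times> real \<Rightarrow> real) \<Rightarrow> bool" where
  "C2_on S u \<longleftrightarrow> C1_on S u \<and> C1_on S (pd2 u) \<and> C1_on S (pd3 u)"

text \<open>Valued in \<open>[0,\<infinity>]\<close>: an estimate with an infinite norm on its right-hand side is void.\<close>

definition Linf_norm :: "(real \<times> real) set \<Rightarrow> (real \<times> real \<Rightarrow> real) \<Rightarrow> ennreal" where
  "Linf_norm S f = esssup (lebesgue_on S) (\<lambda>x. ennreal \<bar>f x\<bar>)"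

definition upward_sausage :: "real \<Rightarrow> real \<times> real \<Rightarrow> (real \<times> real) set" where
  "upward_sausage \<rho> p = (\<Union>t\<in>{0..<\<rho>\<^sup>2}. (\<lambda>x. x + t *\<^sub>R e3) ` ball p \<rho>)"

definition upward_sausages_property :: "(real \<times> real) set \<Rightarrow> bool" where
  "upward_sausages_property \<Omega> \<longleftrightarrow>
     frontier \<Omega> = {} \<or>
     (\<forall>p\<in>\<Omega>. upward_sausage (infdist p (frontier \<Omega>)) p \<subseteq> \<Omega>)"

text \<open>\<open>is_boundary_distance \<Omega> p \<rho>\<close> expresses \<open>\<rho> = dist(p, \<partial>\<Omega>)\<close>. If \<open>\<partial>\<Omega> = {}\<close> then
  \<open>dist(p, \<partial>\<Omega>) = \<infinity>\<close> (whereas \<open>infdist p {} = 0\<close>); an estimate for \<open>\<rho> = \<infinity>\<close> is then read as the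
  family of the estimates for all finite \<open>\<rho>\<close>.\<close>

definition is_boundary_distance :: "(real \<times> real) set \<Rightarrow> real \<times> real \<Rightarrow> real \<Rightarrow> bool" where
  "is_boundary_distance \<Omega> p \<rho> \<longleftrightarrow>
     (if frontier \<Omega> = {} then 0 < \<rho> else \<rho> = infdist p (frontier \<Omega>))"

text \<open>The estimate of \<open>\<partial>\<^sub>2 u\<close> for bounded \<open>L\<close>-harmonic \<open>u\<close>, with exponent \<open>\<alpha>\<close> on \<open>\<rho>\<close> and constant
  \<open>K\<close>, uniformly over all plane domains. It is restricted to \<open>\<rho> \<ge> 1\<close>: at scales \<open>\<rho> < 1\<close> the
  function \<open>x2\<close> on small discs shows that no exponent above \<open>-1\<close> is possible.\<close>

definition harmonic_estimate :: "real \<Rightarrow> real \<Rightarrow> bool" where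
  "harmonic_estimate \<alpha> K \<longleftrightarrow>
     (\<forall>\<Omega> p \<rho> u. open \<Omega> \<and> connected \<Omega> \<and> p \<in> \<Omega> \<and> is_boundary_distance \<Omega> p \<rho> \<and> 1 \<le> \<rho> \<and>
        C2_on \<Omega> u \<and> bounded (u ` \<Omega>) \<and> (\<forall>x\<in>\<Omega>. drift_laplacian u x = 0) \<longrightarrow>
        ennreal \<bar>pd2 u p\<bar> \<le> ennreal K * (ennreal (\<rho> powr \<alpha>) * Linf_norm \<Omega> u))"

end

theory Submission
  imports Defs
begin

text \<open>If \<open>u\<close> is a function of \<open>(x2, x3)\<close>, then \<open>U x y m = u (x, y + m)\<close> satisfies
  \<open>\<partial>\<^sub>x\<^sup>2 U + \<partial>\<^sub>y\<^sup>2 U + \<partial>\<^sub>m U = L u (x, y + m)\<close>, and \<open>u\<close> is defined on \<open>S\<^sup>+\<^sub>\<rho>(p)\<close> exactly if \<open>U\<close> is defined on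
  \<open>B\<^sub>\<rho>(p) \<times> [0, \<rho>\<^sup>2)\<close>. So the estimate on a sausage is the gradient estimate for the backward heat
  equation in two space dimensions. The latter follows by Brandt's method: the odd part of \<open>U\<close> in
  \<open>x\<close> or in \<open>y\<close> vanishes on the hyperplane of reflection and is compared with an explicit barrier.
  The ball \<open>B\<^sub>\<rho>(p)\<close> contains a sausage of width \<open>\<surd>\<rho> / 2\<close> if \<open>\<rho> \<ge> 1\<close>, and of width \<open>\<rho> / 2\<close> otherwise.
  The exponent \<open>-1/2\<close> is sharp because of the functions \<open>exp (x3 / \<rho>) * sin (k * x2)\<close> with
  \<open>k\<^sup>2 = 1 / \<rho>\<^sup>2 + 1 / \<rho>\<close> on the lower half-plane, at \<open>(0, - \<rho>)\<close>.\<close>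

section \<open>Maximum principle and barrier for the backward heat equation\<close>

text \<open>If \<open>D > 0\<close>, then \<open>g'\<close> would be positive just to the right of
  its zero \<open>x\<close>, and the mean value theorem would produce a value of \<open>g\<close>
  above the maximum.\<close>

lemma second_deriv_nonpos_at_max:
  fixes g g' :: "real \<Rightarrow> real"
  assumes d: "0 < d"
    and der: "\<And>y. \<bar>y - x\<bar> < d \<Longrightarrow> (g has_real_derivative g' y) (at y)"
    and der2: "(g' has_real_derivative D) (at x)"
    and max: "\<And>y. \<bar>y - x\<bar> < d \<Longrightarrow> g y \<le> g x"
  shows "D \<le> 0"
proof (rule ccontr)
  assume "\<not> D \<le> 0"
  then obtain e where e: "e > 0" "\<And>h. 0 < h \<Longrightarrow> h < e \<Longrightarrow> g' x < g' (x + h)"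
    using has_real_derivative_pos_inc_right[of g' D x UNIV] der2 by auto
  have "g' x = 0"
    using DERIV_local_max[of g "g' x" x d] der[of x] d max by (simp add: abs_minus_commute)
  define h where "h = min d e / 2"
  have h: "0 < h" "h < d" "h < e" using d e(1) by (auto simp: h_def)
  obtain z where z: "x < z" "z < x + h" "g (x + h) - g x = (x + h - x) * g' z"
    using MVT2[of x "x + h" g g'] der h by auto
  have "g' z > 0" using e(2)[of "z - x"] z h \<open>g' x = 0\<close> by auto
  moreover have "g (x + h) \<le> g x" using max[of "x + h"] h by auto
  ultimately show False using z h by (smt (verit) mult_pos_pos)
qed

text \<open>The function \<open>A * (x\<^sup>2 + y\<^sup>2 + m) + (5 * A + N) / 2 * (x * (r - x))\<close> is a supersolution that dominates
  \<open>f\<close> on the parabolic boundary. The heat equation is a backward one, so no boundary condition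
  is required at \<open>m = 0\<close>.\<close>

lemma heat_barrier:
  fixes f :: "real \<Rightarrow> real \<Rightarrow> real \<Rightarrow> real"
  assumes r: "0 < r"
    and cont: "continuous_on ({0..r} \<times> {-r..r} \<times> {0..r\<^sup>2}) (\<lambda>(x, y, m). f x y m)"
    and zero: "\<And>y m. f 0 y m = 0"
    and bound: "\<And>x y m. \<lbrakk>0 \<le> x; x \<le> r; \<bar>y\<bar> \<le> r; 0 \<le> m; m \<le> r\<^sup>2\<rbrakk> \<Longrightarrow> f x y m \<le> M"
    and dx: "\<And>x y m. \<lbrakk>0 < x; x < r; \<bar>y\<bar> < r; 0 \<le> m; m < r\<^sup>2\<rbrakk>
       \<Longrightarrow> ((\<lambda>x. f x y m) has_real_derivative fx x y m) (at x)"
    and dxx: "\<And>x y m. \<lbrakk>0 < x; x < r; \<bar>y\<bar> < r; 0 \<le> m; m < r\<^sup>2\<rbrakk>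
       \<Longrightarrow> ((\<lambda>x. fx x y m) has_real_derivative fxx x y m) (at x)"
    and dy: "\<And>x y m. \<lbrakk>0 < x; x < r; \<bar>y\<bar> < r; 0 \<le> m; m < r\<^sup>2\<rbrakk>
       \<Longrightarrow> ((\<lambda>y. f x y m) has_real_derivative fy x y m) (at y)"
    and dyy: "\<And>x y m. \<lbrakk>0 < x; x < r; \<bar>y\<bar> < r; 0 \<le> m; m < r\<^sup>2\<rbrakk>
       \<Longrightarrow> ((\<lambda>y. fy x y m) has_real_derivative fyy x y m) (at y)"
    and dm: "\<And>x y m. \<lbrakk>0 < x; x < r; \<bar>y\<bar> < r; 0 \<le> m; m < r\<^sup>2\<rbrakk>
       \<Longrightarrow> ((\<lambda>m. f x y m) has_real_derivative fm x y m) (at m)"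
    and heat: "\<And>x y m. \<lbrakk>0 < x; x < r; \<bar>y\<bar> < r; 0 \<le> m; m < r\<^sup>2\<rbrakk>
       \<Longrightarrow> fxx x y m + fyy x y m + fm x y m > - N"
    and M: "0 \<le> M" and N: "0 \<le> N" and x: "0 \<le> x" "x \<le> r"
  defines "A \<equiv> M / r\<^sup>2"
  shows "f x 0 0 \<le> A * x\<^sup>2 + (5 * A + N) / 2 * (x * (r - x))"
proof -
  \<comment> \<open>The barrier has second derivatives \<open>2 * A - 2 * B\<close> in
    \<open>x\<close> and \<open>2 * A\<close> in \<open>y\<close>, and first derivative
    \<open>A\<close> in \<open>m\<close>; this \<open>B\<close> makes their sum
    \<open>5 * A - 2 * B\<close> equal to \<open>- N\<close>.\<close>
  define B where "B = (5 * A + N) / 2"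
  have A: "0 \<le> A" "A * r\<^sup>2 = M" using M r by (auto simp: A_def)
  have B: "0 \<le> B" using A N by (auto simp: B_def)
  define z where "z = (\<lambda>x y m. f x y m - (A * (x\<^sup>2 + y\<^sup>2 + m) + B * (x * (r - x))))"
  let ?D = "{0..r} \<times> {-r..r} \<times> {0..r\<^sup>2}"
  have "continuous_on ?D (\<lambda>(x, y, m). z x y m)"
    using cont unfolding z_def case_prod_unfold by (intro continuous_intros) auto
  moreover have "compact ?D" by (intro compact_Times) auto
  moreover have "(0, 0, 0) \<in> ?D" using r by auto
  ultimately obtain a b c where D: "(a, b, c) \<in> ?D"
    and max: "\<And>x y m. (x, y, m) \<in> ?D \<Longrightarrow> z x y m \<le> z a b c"
    using continuous_attains_sup[of ?D "\<lambda>(x, y, m). z x y m"] by fastforce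
  have "z a b c \<le> 0"
  \<comment> \<open>The face \<open>c = 0\<close> is left to the interior case. On the face
    \<open>a = 0\<close> the function \<open>f\<close> vanishes; on each of the others one of the
    three terms with coefficient \<open>A\<close> has reached \<open>M\<close>.\<close>
  proof (cases "a = 0 \<or> a = r \<or> \<bar>b\<bar> = r \<or> c = r\<^sup>2")
    case True
    have nn: "0 \<le> A * a\<^sup>2" "0 \<le> A * b\<^sup>2" "0 \<le> A * c" "0 \<le> B * (a * (r - a))"
      using A B D by auto
    show ?thesis
    proof (cases "a = 0")
      case True
      then show ?thesis using zero nn by (auto simp: z_def algebra_simps)
    next
      case False
      then have "M \<le> A * a\<^sup>2 \<or> M \<le> A * b\<^sup>2 \<or> M \<le> A * c"
        using True A(2) by (metis order_refl power2_abs)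
      moreover have "f a b c \<le> M" using D by (intro bound) auto
      ultimately show ?thesis using nn by (auto simp: z_def distrib_left)
    qed
  next
    case False
    then have abc: "0 < a" "a < r" "\<bar>b\<bar> < r" "0 \<le> c" "c < r\<^sup>2" using D by auto
    have "fxx a b c - (2 * A - 2 * B) \<le> 0"
    proof (rule second_deriv_nonpos_at_max)
      show "0 < min a (r - a)" using abc by auto
      show "((\<lambda>x. z x b c) has_real_derivative fx y b c - (2 * A * y + B * (r - 2 * y))) (at y)"
        if "\<bar>y - a\<bar> < min a (r - a)" for y
        unfolding z_def using that abc by (auto intro!: derivative_eq_intros dx simp: algebra_simps)
      show "((\<lambda>y. fx y b c - (2 * A * y + B * (r - 2 * y))) has_real_derivative
          fxx a b c - (2 * A - 2 * B)) (at a)"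
        using abc by (auto intro!: derivative_eq_intros dxx simp: algebra_simps)
      show "z y b c \<le> z a b c" if "\<bar>y - a\<bar> < min a (r - a)" for y
        using that D by (intro max) auto
    qed
    moreover have "fyy a b c - 2 * A \<le> 0"
    proof (rule second_deriv_nonpos_at_max)
      show "0 < r - \<bar>b\<bar>" using abc by auto
      show "((\<lambda>y. z a y c) has_real_derivative fy a y c - 2 * A * y) (at y)"
        if "\<bar>y - b\<bar> < r - \<bar>b\<bar>" for y
        unfolding z_def using that abc by (auto intro!: derivative_eq_intros dy simp: algebra_simps)
      show "((\<lambda>y. fy a y c - 2 * A * y) has_real_derivative fyy a b c - 2 * A) (at b)"
        using abc by (auto intro!: derivative_eq_intros dyy simp: algebra_simps)
      show "z a y c \<le> z a b c" if "\<bar>y - b\<bar> < r - \<bar>b\<bar>" for y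
        using that D by (intro max) auto
    qed
    \<comment> \<open>Here \<open>c = 0\<close> is possible, so only increments to the right are
      compared.\<close>
    moreover have "fm a b c - A \<le> 0"
    proof (rule ccontr)
      assume pos: "\<not> fm a b c - A \<le> 0"
      have "((\<lambda>m. z a b m) has_real_derivative fm a b c - A) (at c)"
        unfolding z_def using abc by (auto intro!: derivative_eq_intros dm)
      then obtain e where e: "e > 0" "\<And>h. 0 < h \<Longrightarrow> h < e \<Longrightarrow> z a b c < z a b (c + h)"
        using has_real_derivative_pos_inc_right[of "\<lambda>m. z a b m" "fm a b c - A" c UNIV] pos by auto
      define h where "h = min (e / 2) (r\<^sup>2 - c)"
      have "0 < h" "h < e" "c + h \<le> r\<^sup>2" using e(1) abc by (auto simp: h_def)
      then have "z a b (c + h) \<le> z a b c" using D by (intro max) auto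
      then show False using e(2)[of h] \<open>0 < h\<close> \<open>h < e\<close> by auto
    qed
    \<comment> \<open>The three derivative tests add up to a contradiction with the strict
      inequality \<open>heat\<close>, so the maximum never falls into the interior case.\<close>
    ultimately have "fxx a b c + fyy a b c + fm a b c \<le> - N"
      by (simp add: B_def field_simps)
    then show ?thesis using heat[OF abc] by simp
  qed
  moreover have "z x 0 0 \<le> z a b c" using x r by (intro max) auto
  ultimately show ?thesis by (simp add: z_def B_def)
qed

text \<open>On the line \<open>y = m = 0\<close> both \<open>f\<close> and its barrier vanish at
  \<open>x = 0\<close> and the barrier lies above, so its slope there bounds that of
  \<open>f\<close>.\<close>

lemma heat_odd_derivative_le:
  fixes f :: "real \<Rightarrow> real \<Rightarrow> real \<Rightarrow> real"
  assumes r: "0 < r"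
    and cont: "continuous_on ({0..r} \<times> {-r..r} \<times> {0..r\<^sup>2}) (\<lambda>(x, y, m). f x y m)"
    and zero: "\<And>y m. f 0 y m = 0"
    and bound: "\<And>x y m. \<lbrakk>0 \<le> x; x \<le> r; \<bar>y\<bar> \<le> r; 0 \<le> m; m \<le> r\<^sup>2\<rbrakk> \<Longrightarrow> f x y m \<le> M"
    and dx: "\<And>x y m. \<lbrakk>0 \<le> x; x < r; \<bar>y\<bar> < r; 0 \<le> m; m < r\<^sup>2\<rbrakk>
       \<Longrightarrow> ((\<lambda>x. f x y m) has_real_derivative fx x y m) (at x)"
    and dxx: "\<And>x y m. \<lbrakk>0 < x; x < r; \<bar>y\<bar> < r; 0 \<le> m; m < r\<^sup>2\<rbrakk>
       \<Longrightarrow> ((\<lambda>x. fx x y m) has_real_derivative fxx x y m) (at x)"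
    and dy: "\<And>x y m. \<lbrakk>0 < x; x < r; \<bar>y\<bar> < r; 0 \<le> m; m < r\<^sup>2\<rbrakk>
       \<Longrightarrow> ((\<lambda>y. f x y m) has_real_derivative fy x y m) (at y)"
    and dyy: "\<And>x y m. \<lbrakk>0 < x; x < r; \<bar>y\<bar> < r; 0 \<le> m; m < r\<^sup>2\<rbrakk>
       \<Longrightarrow> ((\<lambda>y. fy x y m) has_real_derivative fyy x y m) (at y)"
    and dm: "\<And>x y m. \<lbrakk>0 < x; x < r; \<bar>y\<bar> < r; 0 \<le> m; m < r\<^sup>2\<rbrakk>
       \<Longrightarrow> ((\<lambda>m. f x y m) has_real_derivative fm x y m) (at m)"
    and heat: "\<And>x y m. \<lbrakk>0 < x; x < r; \<bar>y\<bar> < r; 0 \<le> m; m < r\<^sup>2\<rbrakk>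
       \<Longrightarrow> fxx x y m + fyy x y m + fm x y m \<ge> - N"
    and M: "0 \<le> M" and N: "0 \<le> N"
  shows "fx 0 0 0 \<le> 5 / 2 * M / r + r * N / 2"
proof (rule field_le_epsilon)
  fix e :: real assume e: "0 < e"
  \<comment> \<open>The excess over \<open>N\<close> makes the inequality strict, as
    \<open>heat_barrier\<close> requires, and raises the term \<open>r * N / 2\<close> of the slope
    by exactly \<open>e\<close>.\<close>
  define N' where "N' = N + 2 * e / r"
  define A where "A = M / r\<^sup>2"
  define h where "h = (\<lambda>x. A * x\<^sup>2 + (5 * A + N') / 2 * (x * (r - x)) - f x 0 0)"
  have N': "N < N'" using e r by (simp add: N'_def)
  have h0: "0 \<le> h x" if "0 \<le> x" "x \<le> r" for x
  proof -
    have "f x 0 0 \<le> M / r\<^sup>2 * x\<^sup>2 + (5 * (M / r\<^sup>2) + N') / 2 * (x * (r - x))"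
      using r cont zero bound dx dxx dy dyy dm _ M _ that
    proof (rule heat_barrier)
      show "0 \<le> N'" using N N' by simp
      show "- N' < fxx x y m + fyy x y m + fm x y m"
        if "0 < x" "x < r" "\<bar>y\<bar> < r" "0 \<le> m" "m < r\<^sup>2" for x y m
        using heat[OF that] N' by simp
    qed auto
    then show ?thesis by (simp add: h_def A_def)
  qed
  have "(h has_real_derivative (5 * A + N') / 2 * r - fx 0 0 0) (at 0)"
    unfolding h_def using r by (auto intro!: derivative_eq_intros dx)
  then have "0 \<le> (5 * A + N') / 2 * r - fx 0 0 0"
  proof (rule contrapos_pp)
    assume "\<not> 0 \<le> (5 * A + N') / 2 * r - fx 0 0 0"
    then have neg: "(5 * A + N') / 2 * r - fx 0 0 0 < 0" by simp
    show "\<not> (h has_real_derivative (5 * A + N') / 2 * r - fx 0 0 0) (at 0)"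
    proof
      assume "(h has_real_derivative (5 * A + N') / 2 * r - fx 0 0 0) (at 0)"
      from has_real_derivative_neg_dec_right[OF this neg] obtain d where
        d: "0 < d" "\<And>s. 0 < s \<Longrightarrow> s < d \<Longrightarrow> h s < h 0" by auto
      have "h (min (d / 2) r) < h 0" using d r by auto
      moreover have "h 0 = 0" using zero by (simp add: h_def)
      ultimately show False using h0[of "min (d / 2) r"] d r by auto
    qed
  qed
  also have "(5 * A + N') / 2 * r = 5 / 2 * M / r + r * N / 2 + e"
    using r by (simp add: A_def N'_def field_simps power2_eq_square)
  finally show "fx 0 0 0 \<le> 5 / 2 * M / r + r * N / 2 + e" by simp
qed


text \<open>By linearity the one-sided bound applies to \<open>f\<close> and to
  \<open>- f\<close>.\<close>

lemma heat_odd_derivative_abs_le: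
  fixes f :: "real \<Rightarrow> real \<Rightarrow> real \<Rightarrow> real"
  assumes r: "0 < r"
    and cont: "continuous_on ({0..r} \<times> {-r..r} \<times> {0..r\<^sup>2}) (\<lambda>(x, y, m). f x y m)"
    and zero: "\<And>y m. f 0 y m = 0"
    and bound: "\<And>x y m. \<lbrakk>0 \<le> x; x \<le> r; \<bar>y\<bar> \<le> r; 0 \<le> m; m \<le> r\<^sup>2\<rbrakk> \<Longrightarrow> \<bar>f x y m\<bar> \<le> M"
    and der: "\<And>x y m. \<lbrakk>0 \<le> x; x < r; \<bar>y\<bar> < r; 0 \<le> m; m < r\<^sup>2\<rbrakk> \<Longrightarrow>
       ((\<lambda>x. f x y m) has_real_derivative fx x y m) (at x) \<and>
       ((\<lambda>x. fx x y m) has_real_derivative fxx x y m) (at x) \<and>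
       ((\<lambda>y. f x y m) has_real_derivative fy x y m) (at y) \<and>
       ((\<lambda>y. fy x y m) has_real_derivative fyy x y m) (at y) \<and>
       ((\<lambda>m. f x y m) has_real_derivative fm x y m) (at m) \<and>
       \<bar>fxx x y m + fyy x y m + fm x y m\<bar> \<le> N"
    and M: "0 \<le> M" and N: "0 \<le> N"
  shows "\<bar>fx 0 0 0\<bar> \<le> 5 / 2 * M / r + r * N / 2"
proof -
  have "fx 0 0 0 \<le> 5 / 2 * M / r + r * N / 2"
  proof (rule heat_odd_derivative_le[where f = f and fx = fx and fxx = fxx
        and fy = fy and fyy = fyy and fm = fm, OF r cont zero])
    show "f x y m \<le> M" if "0 \<le> x" "x \<le> r" "\<bar>y\<bar> \<le> r" "0 \<le> m" "m \<le> r\<^sup>2" for x y m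
      using bound[OF that] by simp
    show "- N \<le> fxx x y m + fyy x y m + fm x y m"
      if "0 < x" "x < r" "\<bar>y\<bar> < r" "0 \<le> m" "m < r\<^sup>2" for x y m
      using der[of x y m] that by auto
  qed (use der M N in auto)
  moreover have "- fx 0 0 0 \<le> 5 / 2 * M / r + r * N / 2"
  proof (rule heat_odd_derivative_le[where f = "\<lambda>x y m. - f x y m" and fx = "\<lambda>x y m. - fx x y m"
        and fxx = "\<lambda>x y m. - fxx x y m" and fy = "\<lambda>x y m. - fy x y m"
        and fyy = "\<lambda>x y m. - fyy x y m" and fm = "\<lambda>x y m. - fm x y m", OF r])
    show "continuous_on ({0..r} \<times> {- r..r} \<times> {0..r\<^sup>2}) (\<lambda>(x, y, m). - f x y m)"
      using continuous_on_minus[OF cont] by (simp add: case_prod_unfold)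
    show "- f x y m \<le> M" if "0 \<le> x" "x \<le> r" "\<bar>y\<bar> \<le> r" "0 \<le> m" "m \<le> r\<^sup>2" for x y m
      using bound[OF that] by simp
    show "- N \<le> - fxx x y m + - fyy x y m + - fm x y m"
      if "0 < x" "x < r" "\<bar>y\<bar> < r" "0 \<le> m" "m < r\<^sup>2" for x y m
      using der[of x y m] that by auto
  qed (use der zero M N in \<open>auto intro!: DERIV_minus\<close>)
  ultimately show ?thesis by simp
qed

section \<open>Functions with continuous partial derivatives\<close>

text \<open>Only one coordinate moves, so the one-variable chain rule suffices. In the reflections
  and shifts below \<open>g\<close> is affine, such as \<open>\<lambda>t. a - t\<close>.\<close>

lemma C1_on_chain_pd2:
  assumes "C1_on S u" "(g t, b) \<in> S" "(g has_real_derivative g') (at t)"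
  shows "((\<lambda>t. u (g t, b)) has_real_derivative pd2 u (g t, b) * g') (at t)"
proof -
  have "((\<lambda>s. u (s, b)) has_real_derivative pd2 u (g t, b)) (at (g t))"
    using assms(1,2) by (force simp: C1_on_def pd2_def DERIV_deriv_iff_real_differentiable)
  from DERIV_chain2[OF this assms(3)] show ?thesis .
qed

lemma C1_on_chain_pd3:
  assumes "C1_on S u" "(a, g t) \<in> S" "(g has_real_derivative g') (at t)"
  shows "((\<lambda>t. u (a, g t)) has_real_derivative pd3 u (a, g t) * g') (at t)"
proof -
  have "((\<lambda>s. u (a, s)) has_real_derivative pd3 u (a, g t)) (at (g t))"
    using assms(1,2) by (force simp: C1_on_def pd3_def DERIV_deriv_iff_real_differentiable)
  from DERIV_chain2[OF this assms(3)] show ?thesis .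
qed

text \<open>\<open>C1_on\<close> gives continuity of \<open>u\<close> itself only along coordinate
  lines. Near the point \<open>pd3 u\<close> is bounded, so vertical increments of \<open>u\<close>
  are uniformly small, and the remaining horizontal increment runs along one fixed line.\<close>

lemma C1_on_imp_continuous_on:
  assumes "open S" "C1_on S u"
  shows "continuous_on S u"
proof (rule continuous_at_imp_continuous_on, safe)
  fix a b assume ab: "(a, b) \<in> S"
  have "isCont (pd3 u) (a, b)"
    using assms ab by (auto simp: C1_on_def continuous_on_eq_continuous_at)
  then have "\<forall>\<^sub>F x in at (a, b). \<bar>pd3 u x - pd3 u (a, b)\<bar> < 1"
    unfolding isCont_def tendsto_iff dist_real_def by auto
  then obtain d1 where d1: "d1 > 0"
    "\<And>x. x \<noteq> (a, b) \<Longrightarrow> dist x (a, b) < d1 \<Longrightarrow> \<bar>pd3 u x - pd3 u (a, b)\<bar> < 1"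
    unfolding eventually_at by auto
  obtain d2 where d2: "d2 > 0" "ball (a, b) d2 \<subseteq> S"
    using assms(1) ab open_contains_ball by blast
  define d where "d = min d1 d2"
  define C where "C = \<bar>pd3 u (a, b)\<bar> + 1"
  have d: "d > 0" "ball (a, b) d \<subseteq> S" using d1 d2 by (auto simp: d_def)
  have C: "\<bar>pd3 u x\<bar> \<le> C" if "x \<in> ball (a, b) d" for x
    using d1(2)[of x] that by (cases "x = (a, b)") (auto simp: C_def d_def dist_commute)
  have bnd: "\<bar>u x - u (a, b)\<bar> \<le> C * \<bar>snd x - b\<bar> + \<bar>u (fst x, b) - u (a, b)\<bar>"
    if x: "x \<in> ball (a, b) d" for x
  proof -
    \<comment> \<open>Moving the second coordinate towards \<open>b\<close> does not increase the
      distance to \<open>(a, b)\<close>, so the vertical segment stays in the ball.\<close>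
    have seg: "(fst x, t) \<in> ball (a, b) d" if "t \<in> closed_segment b (snd x)" for t
    proof -
      have "\<bar>b - t\<bar> \<le> \<bar>b - snd x\<bar>"
        using that by (auto simp: closed_segment_eq_real_ivl split: if_splits)
      then have "(b - t)\<^sup>2 \<le> (b - snd x)\<^sup>2" by (simp add: abs_le_square_iff)
      then have "dist (a, b) (fst x, t) \<le> dist (a, b) x"
        by (cases x) (simp add: dist_prod_def dist_real_def)
      then show ?thesis using x by simp
    qed
    have "norm (u (fst x, snd x) - u (fst x, b)) \<le> C * norm (snd x - b)"
    proof (rule field_differentiable_bound[of "closed_segment b (snd x)" "\<lambda>t. u (fst x, t)"
          "\<lambda>t. pd3 u (fst x, t)"])
      show "((\<lambda>t. u (fst x, t)) has_real_derivative pd3 u (fst x, t))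
          (at t within closed_segment b (snd x))" if "t \<in> closed_segment b (snd x)" for t
        using C1_on_chain_pd3[OF assms(2), of "fst x" "\<lambda>t. t" t 1] subsetD[OF d(2) seg[OF that]]
        by (auto intro: has_field_derivative_at_within)
      show "norm (pd3 u (fst x, t)) \<le> C" if "t \<in> closed_segment b (snd x)" for t
        using C[OF seg[OF that]] by simp
    qed auto
    then show ?thesis by simp
  qed
  have "isCont (\<lambda>s. u (s, b)) a"
    using C1_on_chain_pd2[OF assms(2), of "\<lambda>t. t" a b 1] ab by (auto intro: DERIV_isCont)
  then have "((\<lambda>x. u (fst x, b)) \<longlongrightarrow> u (a, b)) (at (a, b))"
    using isCont_tendsto_compose[of a "\<lambda>s. u (s, b)" fst "at (a, b)"] tendsto_fst[OF tendsto_ident_at, of "(a, b)"]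
    by auto
  then have "((\<lambda>x. C * \<bar>snd x - b\<bar> + \<bar>u (fst x, b) - u (a, b)\<bar>) \<longlongrightarrow> 0) (at (a, b))"
    by (auto intro!: tendsto_eq_intros)
  moreover have "\<forall>\<^sub>F x in at (a, b). norm (u x - u (a, b)) \<le> C * \<bar>snd x - b\<bar> + \<bar>u (fst x, b) - u (a, b)\<bar>"
    using d(1) bnd by (auto simp: eventually_at dist_commute intro!: exI[of _ d])
  ultimately have "((\<lambda>x. u x - u (a, b)) \<longlongrightarrow> 0) (at (a, b))"
    by (rule Lim_null_comparison[rotated])
  then show "isCont u (a, b)" unfolding isCont_def by (rule LIM_zero_cancel)
qed


section \<open>Upward sausages and the pointwise gradient bound on them\<close>

lemma open_upward_sausage: "open (upward_sausage \<rho> p)"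
proof -
  have "open ((\<lambda>x. x + t *\<^sub>R e3) ` ball p \<rho>)" for t
    using open_translation[OF open_ball, of "t *\<^sub>R e3" p \<rho>] by (simp add: add.commute)
  then show ?thesis by (auto simp: upward_sausage_def)
qed

lemma mem_upward_sausageI:
  assumes "0 < \<rho>" "x\<^sup>2 + y\<^sup>2 < \<rho>\<^sup>2" "0 \<le> t" "t < \<rho>\<^sup>2"
  shows "(fst p + x, snd p + y + t) \<in> upward_sausage \<rho> p"
proof -
  have "dist p (fst p + x, snd p + y) = sqrt (x\<^sup>2 + y\<^sup>2)"
    by (cases p) (simp add: dist_prod_def dist_real_def)
  also have "\<dots> < \<rho>" using assms(1,2) by (metis real_less_lsqrt less_imp_le)
  finally have "(fst p + x, snd p + y) \<in> ball p \<rho>" by simp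
  then have "(fst p + x, snd p + y) + t *\<^sub>R e3 \<in> (\<lambda>x. x + t *\<^sub>R e3) ` ball p \<rho>"
    by (rule imageI)
  then have "(fst p + x, snd p + y) + t *\<^sub>R e3 \<in> upward_sausage \<rho> p"
    unfolding upward_sausage_def by (rule UN_I[rotated]) (use assms(3,4) in simp)
  then show ?thesis by (simp add: e3_def)
qed

text \<open>The upward shift adds less than \<open>r\<^sup>2\<close> to a distance from
  \<open>p\<close> that is less than \<open>r\<close>.\<close>

lemma upward_sausage_subset_ball:
  assumes "r + r\<^sup>2 \<le> \<rho>"
  shows "upward_sausage r p \<subseteq> ball p \<rho>"
proof -
  have "dist p (x + t *\<^sub>R e3) < \<rho>" if "dist p x < r" "0 \<le> t" "t < r\<^sup>2" for x t
  proof -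
    have "dist x (x + t *\<^sub>R e3) = t" using that by (simp add: dist_norm e3_def norm_prod_def)
    then show ?thesis using dist_triangle[of p "x + t *\<^sub>R e3" x] that assms by linarith
  qed
  then show ?thesis by (auto simp: upward_sausage_def)
qed

text \<open>The bounds are taken over a set \<open>S\<close> around the sausage, so that the same
  lemma serves for the sausage, for a ball and for a whole domain.\<close>

lemma gradient_bound_on_sausage:
  assumes \<rho>: "0 < \<rho>" and S: "open S" "upward_sausage \<rho> p \<subseteq> S" and u: "C2_on S u"
    and M: "\<And>x. x \<in> S \<Longrightarrow> \<bar>u x\<bar> \<le> M" and N: "\<And>x. x \<in> S \<Longrightarrow> \<bar>drift_laplacian u x\<bar> \<le> N"
  shows "norm (gradient u p) \<le> 10 * (M / \<rho> + \<rho> * N)"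
proof -
  obtain a b where p: "p = (a, b)" by (cases p)
  \<comment> \<open>The closed square of half-side \<open>r\<close> fits into the open disc because
    \<open>2 * r\<^sup>2 = \<rho>\<^sup>2 / 2\<close>.\<close>
  define r where "r = \<rho> / 2"
  have r: "0 < r" using \<rho> by (simp add: r_def)
  have mem: "(a + x, b + y + m) \<in> S" if "\<bar>x\<bar> \<le> r" "\<bar>y\<bar> \<le> r" "0 \<le> m" "m \<le> r\<^sup>2" for x y m
  proof -
    have "x\<^sup>2 \<le> r\<^sup>2" "y\<^sup>2 \<le> r\<^sup>2" using that r by (simp_all add: abs_le_square_iff[symmetric])
    moreover have "2 * r\<^sup>2 < \<rho>\<^sup>2" "r\<^sup>2 < \<rho>\<^sup>2" using \<rho> by (simp_all add: r_def power2_eq_square)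
    ultimately show ?thesis
      using mem_upward_sausageI[of \<rho> x y m p] that \<rho> S(2) p by auto
  qed
  have mem': "(a - x, b + y + m) \<in> S" "(a + y, b + x + m) \<in> S" "(a + y, b - x + m) \<in> S"
    "(a + x, b + y + m) \<in> S"
    if "0 \<le> x" "x \<le> r" "\<bar>y\<bar> \<le> r" "0 \<le> m" "m \<le> r\<^sup>2" for x y m
    using mem[of "-x" y m] mem[of y x m] mem[of y "-x" m] mem[of x y m] that by auto
  have C1: "C1_on S u" "C1_on S (pd2 u)" "C1_on S (pd3 u)" using u by (auto simp: C2_on_def)
  note chain = C1(1)[THEN C1_on_chain_pd2] C1(1)[THEN C1_on_chain_pd3] C1(2)[THEN C1_on_chain_pd2]
    C1(2)[THEN C1_on_chain_pd3] C1(3)[THEN C1_on_chain_pd2] C1(3)[THEN C1_on_chain_pd3]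
  have cont: "continuous_on S u" using S C1 C1_on_imp_continuous_on by blast
  have pS: "p \<in> S" using mem[of 0 0 0] p r by simp
  have MN: "0 \<le> M" "0 \<le> N" using M[OF pS] N[OF pS] by auto
  have L: "drift_laplacian u x = pd2 (pd2 u) x + pd3 (pd3 u) x + pd3 u x" for x
    by (simp add: drift_laplacian_def laplacian_def gradient_def e3_def)
  let ?D = "{0..r} \<times> {-r..r} \<times> {0..r\<^sup>2}"
  \<comment> \<open>This is the odd part in the first coordinate. An increment of \<open>m\<close>
    moves the second coordinate, so \<open>fm\<close> is again built from \<open>pd3 u\<close>, and
    the heat operator yields half the difference of \<open>drift_laplacian u\<close> at the two
    mirror points.\<close>
  have "\<bar>(\<lambda>x y m. (pd2 u (a + x, b + y + m) + pd2 u (a - x, b + y + m)) / 2) 0 0 0\<bar>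
     \<le> 5 / 2 * M / r + r * N / 2"
  proof (rule heat_odd_derivative_abs_le[where
        f = "\<lambda>x y m. (u (a + x, b + y + m) - u (a - x, b + y + m)) / 2" and
        fx = "\<lambda>x y m. (pd2 u (a + x, b + y + m) + pd2 u (a - x, b + y + m)) / 2" and
        fxx = "\<lambda>x y m. (pd2 (pd2 u) (a + x, b + y + m) - pd2 (pd2 u) (a - x, b + y + m)) / 2" and
        fy = "\<lambda>x y m. (pd3 u (a + x, b + y + m) - pd3 u (a - x, b + y + m)) / 2" and
        fm = "\<lambda>x y m. (pd3 u (a + x, b + y + m) - pd3 u (a - x, b + y + m)) / 2" and
        fyy = "\<lambda>x y m. (pd3 (pd3 u) (a + x, b + y + m) - pd3 (pd3 u) (a - x, b + y + m)) / 2",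
        OF r])
    have *: "continuous_on ?D (\<lambda>z. u (a + fst z, b + fst (snd z) + snd (snd z)))"
      "continuous_on ?D (\<lambda>z. u (a - fst z, b + fst (snd z) + snd (snd z)))"
      by (rule continuous_on_compose2[OF cont], intro continuous_intros, use mem' in auto)+
    show "continuous_on ?D (\<lambda>(x, y, m). (u (a + x, b + y + m) - u (a - x, b + y + m)) / 2)"
      unfolding case_prod_unfold by (intro continuous_intros *) auto
    show "\<bar>(u (a + x, b + y + m) - u (a - x, b + y + m)) / 2\<bar> \<le> M"
      if "0 \<le> x" "x \<le> r" "\<bar>y\<bar> \<le> r" "0 \<le> m" "m \<le> r\<^sup>2" for x y m
      using mem'[OF that, THEN M] by (auto simp: abs_le_iff)
    fix x y m assume xym: "0 \<le> x" "x < r" "\<bar>y\<bar> < r" "0 \<le> m" "m < r\<^sup>2"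
    then have "x \<le> r" "\<bar>y\<bar> \<le> r" "m \<le> r\<^sup>2" by auto
    note S' = mem'[OF xym(1) this(1,2) xym(4) this(3)]
    have "\<bar>(drift_laplacian u (a + x, b + y + m) - drift_laplacian u (a - x, b + y + m)) / 2\<bar> \<le> N"
      using S'[THEN N] by (auto simp: abs_le_iff)
    then show "((\<lambda>x. (u (a + x, b + y + m) - u (a - x, b + y + m)) / 2) has_real_derivative
        (pd2 u (a + x, b + y + m) + pd2 u (a - x, b + y + m)) / 2) (at x) \<and>
      ((\<lambda>x. (pd2 u (a + x, b + y + m) + pd2 u (a - x, b + y + m)) / 2) has_real_derivative
        (pd2 (pd2 u) (a + x, b + y + m) - pd2 (pd2 u) (a - x, b + y + m)) / 2) (at x) \<and>
      ((\<lambda>y. (u (a + x, b + y + m) - u (a - x, b + y + m)) / 2) has_real_derivative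
        (pd3 u (a + x, b + y + m) - pd3 u (a - x, b + y + m)) / 2) (at y) \<and>
      ((\<lambda>y. (pd3 u (a + x, b + y + m) - pd3 u (a - x, b + y + m)) / 2) has_real_derivative
        (pd3 (pd3 u) (a + x, b + y + m) - pd3 (pd3 u) (a - x, b + y + m)) / 2) (at y) \<and>
      ((\<lambda>m. (u (a + x, b + y + m) - u (a - x, b + y + m)) / 2) has_real_derivative
        (pd3 u (a + x, b + y + m) - pd3 u (a - x, b + y + m)) / 2) (at m) \<and>
      \<bar>(pd2 (pd2 u) (a + x, b + y + m) - pd2 (pd2 u) (a - x, b + y + m)) / 2 +
        (pd3 (pd3 u) (a + x, b + y + m) - pd3 (pd3 u) (a - x, b + y + m)) / 2 +
        (pd3 u (a + x, b + y + m) - pd3 u (a - x, b + y + m)) / 2\<bar> \<le> N"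
      using S' unfolding L
      by (intro conjI) (auto intro!: derivative_eq_intros chain simp: field_simps)
  qed (use MN in auto)
  \<comment> \<open>The second coordinate now takes the role of \<open>x\<close>. Reflecting
    \<open>u\<close> itself would reverse the drift; here only \<open>x\<close> changes sign while
    \<open>m\<close> shifts both mirror points upwards, so the drift terms keep their form.\<close>
  moreover have "\<bar>(\<lambda>x y m. (pd3 u (a + y, b + x + m) + pd3 u (a + y, b - x + m)) / 2) 0 0 0\<bar>
     \<le> 5 / 2 * M / r + r * N / 2"
  proof (rule heat_odd_derivative_abs_le[where
        f = "\<lambda>x y m. (u (a + y, b + x + m) - u (a + y, b - x + m)) / 2" and
        fx = "\<lambda>x y m. (pd3 u (a + y, b + x + m) + pd3 u (a + y, b - x + m)) / 2" and
        fxx = "\<lambda>x y m. (pd3 (pd3 u) (a + y, b + x + m) - pd3 (pd3 u) (a + y, b - x + m)) / 2" and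
        fy = "\<lambda>x y m. (pd2 u (a + y, b + x + m) - pd2 u (a + y, b - x + m)) / 2" and
        fm = "\<lambda>x y m. (pd3 u (a + y, b + x + m) - pd3 u (a + y, b - x + m)) / 2" and
        fyy = "\<lambda>x y m. (pd2 (pd2 u) (a + y, b + x + m) - pd2 (pd2 u) (a + y, b - x + m)) / 2",
        OF r])
    have *: "continuous_on ?D (\<lambda>z. u (a + fst (snd z), b + fst z + snd (snd z)))"
      "continuous_on ?D (\<lambda>z. u (a + fst (snd z), b - fst z + snd (snd z)))"
      by (rule continuous_on_compose2[OF cont], intro continuous_intros, use mem' in auto)+
    show "continuous_on ?D (\<lambda>(x, y, m). (u (a + y, b + x + m) - u (a + y, b - x + m)) / 2)"
      unfolding case_prod_unfold by (intro continuous_intros *) auto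
    show "\<bar>(u (a + y, b + x + m) - u (a + y, b - x + m)) / 2\<bar> \<le> M"
      if "0 \<le> x" "x \<le> r" "\<bar>y\<bar> \<le> r" "0 \<le> m" "m \<le> r\<^sup>2" for x y m
      using mem'[OF that, THEN M] by (auto simp: abs_le_iff)
    fix x y m assume xym: "0 \<le> x" "x < r" "\<bar>y\<bar> < r" "0 \<le> m" "m < r\<^sup>2"
    then have "x \<le> r" "\<bar>y\<bar> \<le> r" "m \<le> r\<^sup>2" by auto
    note S' = mem'[OF xym(1) this(1,2) xym(4) this(3)]
    have "\<bar>(drift_laplacian u (a + y, b + x + m) - drift_laplacian u (a + y, b - x + m)) / 2\<bar> \<le> N"
      using S'[THEN N] by (auto simp: abs_le_iff)
    then show "((\<lambda>x. (u (a + y, b + x + m) - u (a + y, b - x + m)) / 2) has_real_derivative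
        (pd3 u (a + y, b + x + m) + pd3 u (a + y, b - x + m)) / 2) (at x) \<and>
      ((\<lambda>x. (pd3 u (a + y, b + x + m) + pd3 u (a + y, b - x + m)) / 2) has_real_derivative
        (pd3 (pd3 u) (a + y, b + x + m) - pd3 (pd3 u) (a + y, b - x + m)) / 2) (at x) \<and>
      ((\<lambda>y. (u (a + y, b + x + m) - u (a + y, b - x + m)) / 2) has_real_derivative
        (pd2 u (a + y, b + x + m) - pd2 u (a + y, b - x + m)) / 2) (at y) \<and>
      ((\<lambda>y. (pd2 u (a + y, b + x + m) - pd2 u (a + y, b - x + m)) / 2) has_real_derivative
        (pd2 (pd2 u) (a + y, b + x + m) - pd2 (pd2 u) (a + y, b - x + m)) / 2) (at y) \<and>
      ((\<lambda>m. (u (a + y, b + x + m) - u (a + y, b - x + m)) / 2) has_real_derivative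
        (pd3 u (a + y, b + x + m) - pd3 u (a + y, b - x + m)) / 2) (at m) \<and>
      \<bar>(pd3 (pd3 u) (a + y, b + x + m) - pd3 (pd3 u) (a + y, b - x + m)) / 2 +
        (pd2 (pd2 u) (a + y, b + x + m) - pd2 (pd2 u) (a + y, b - x + m)) / 2 +
        (pd3 u (a + y, b + x + m) - pd3 u (a + y, b - x + m)) / 2\<bar> \<le> N"
      using S' unfolding L
      by (intro conjI) (auto intro!: derivative_eq_intros chain simp: field_simps)
  qed (use MN in auto)
  \<comment> \<open>With \<open>r = \<rho> / 2\<close> each of the two bounds equals
    \<open>5 * M / \<rho> + \<rho> * N / 4\<close>.\<close>
  ultimately have "\<bar>pd2 u p\<bar> + \<bar>pd3 u p\<bar> \<le> 10 * M / \<rho> + \<rho> * N / 2"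
    using \<rho> by (simp add: p r_def field_simps)
  also have "\<dots> \<le> 10 * (M / \<rho> + \<rho> * N)"
    using MN \<rho> by (simp add: algebra_simps)
  finally show ?thesis
    using norm_Pair_le[of "pd2 u p" "pd3 u p"] by (simp add: gradient_def)
qed

section \<open>From pointwise bounds to essential suprema\<close>

text \<open>For continuous \<open>f\<close> the set where \<open>\<bar>f\<bar>\<close> exceeds its
  essential supremum is open and negligible, hence empty.\<close>

lemma abs_le_Linf_norm:
  assumes S: "open S" "x \<in> S" and f: "continuous_on S f"
  shows "ennreal \<bar>f x\<bar> \<le> Linf_norm S f"
proof (rule ccontr)
  assume "\<not> ennreal \<bar>f x\<bar> \<le> Linf_norm S f"
  then have less: "Linf_norm S f < ennreal \<bar>f x\<bar>" by simp
  then obtain c where c: "0 \<le> c" "Linf_norm S f = ennreal c" by (cases "Linf_norm S f") auto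
  define T where "T = S \<inter> f -` {y. c < \<bar>y\<bar>}"
  have "AE y in lebesgue_on S. ennreal \<bar>f y\<bar> \<le> ennreal c"
    using esssup_AE[of "\<lambda>y. ennreal \<bar>f y\<bar>" "lebesgue_on S"] c by (simp add: Linf_norm_def)
  then have "AE y in lebesgue. y \<in> S \<longrightarrow> ennreal \<bar>f y\<bar> \<le> ennreal c"
    using S by (subst (asm) AE_restrict_space_iff) auto
  then have "AE y in lebesgue. y \<notin> T"
    by eventually_elim (use c in \<open>auto simp: T_def ennreal_le_iff2\<close>)
  moreover have "open {y::real. c < \<bar>y\<bar>}" by (intro open_Collect_less continuous_intros)
  then have "open T" unfolding T_def using S f by (intro continuous_open_preimage) auto
  ultimately have "negligible T"
    by (simp add: negligible_iff_null_sets AE_iff_null_sets)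
  moreover have "x \<in> T" using S less c by (auto simp: T_def ennreal_less_iff)
  ultimately show False using open_not_negligible[OF \<open>open T\<close>] by auto
qed

text \<open>The factor 2 in the conditions on the weights turns the constant 10 into 20 and admits a
  sausage of half the nominal width: \<open>r\<close> will be \<open>\<rho>\<close> or
  \<open>\<rho> / 2\<close> with weights \<open>1 / \<rho>\<close> and \<open>\<rho>\<close>, or
  \<open>sqrt \<rho> / 2\<close> with weights \<open>\<rho> powr (- 1 / 2)\<close> and
  \<open>\<rho> powr (1 / 2)\<close>.\<close>

lemma gradient_estimate:
  assumes r: "0 < r" and S: "open S" "upward_sausage r p \<subseteq> S" and u: "C2_on S u"
    and cd: "1 / r \<le> 2 * c" "r \<le> 2 * d"
  shows "ennreal (norm (gradient u p)) \<le>
    ennreal 20 * (ennreal c * Linf_norm S u + ennreal d * Linf_norm S (drift_laplacian u))"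
proof -
  \<comment> \<open>In \<open>ennreal\<close> the product of \<open>0\<close> and \<open>top\<close>
    is \<open>0\<close>; positive weights ensure that an infinite norm makes the right-hand side
    \<open>top\<close>.\<close>
  have pos: "0 < c" "0 < d" using r cd by (auto simp: zero_less_mult_iff intro: less_le_trans
      [of 0 "1 / r" "2 * c", simplified])
  show ?thesis
  proof (cases "Linf_norm S u = top \<or> Linf_norm S (drift_laplacian u) = top")
    case True
    then show ?thesis using pos by (auto simp: ennreal_mult_top)
  next
    case False
    define M where "M = enn2real (Linf_norm S u)"
    define N where "N = enn2real (Linf_norm S (drift_laplacian u))"
    have MN: "Linf_norm S u = ennreal M" "Linf_norm S (drift_laplacian u) = ennreal N"
      "0 \<le> M" "0 \<le> N"
      using False by (auto simp: M_def N_def less_top)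
    have C1: "C1_on S u" "C1_on S (pd2 u)" "C1_on S (pd3 u)" using u by (auto simp: C2_on_def)
    have "continuous_on S (drift_laplacian u)"
      using C1 unfolding drift_laplacian_def laplacian_def gradient_def e3_def C1_on_def
      by (auto intro!: continuous_intros)
    then have "norm (gradient u p) \<le> 10 * (M / r + r * N)"
      using abs_le_Linf_norm[OF S(1), of _ u] abs_le_Linf_norm[OF S(1), of _ "drift_laplacian u"] MN
        C1_on_imp_continuous_on[OF S(1) C1(1)]
      by (intro gradient_bound_on_sausage[OF r S u]) auto
    also have "\<dots> \<le> 20 * (c * M + d * N)"
      using mult_right_mono[OF cd(1) MN(3)] mult_right_mono[OF cd(2) MN(4)] by simp
    finally have "ennreal (norm (gradient u p)) \<le> ennreal (20 * (c * M + d * N))"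
      by (rule ennreal_leI)
    also have "\<dots> = ennreal 20 * (ennreal c * ennreal M + ennreal d * ennreal N)"
      using MN(3,4) pos by (simp add: ennreal_mult)
    finally show ?thesis by (simp add: MN(1,2))
  qed
qed

lemma C2_on_subset: "C2_on T u \<Longrightarrow> S \<subseteq> T \<Longrightarrow> C2_on S u"
  unfolding C2_on_def C1_on_def by (meson continuous_on_subset subsetD)

section \<open>Boundary distance and the estimates on balls\<close>

text \<open>An open set containing \<open>p\<close> with empty frontier is the whole plane.
  Otherwise the ball is connected, meets \<open>\<Omega>\<close> and misses the frontier, so it
  cannot leave \<open>\<Omega>\<close>.\<close>

lemma is_boundary_distanceD:
  assumes "open \<Omega>" "p \<in> \<Omega>" and \<rho>: "is_boundary_distance \<Omega> p \<rho>"
  shows "0 < \<rho>" "ball p \<rho> \<subseteq> \<Omega>"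
proof -
  have "0 < \<rho> \<and> ball p \<rho> \<subseteq> \<Omega>"
  proof (cases "frontier \<Omega> = {}")
    case True
    then show ?thesis using assms by (auto simp: is_boundary_distance_def frontier_eq_empty)
  next
    case False
    then have \<rho>: "\<rho> = infdist p (frontier \<Omega>)" using \<rho> by (simp add: is_boundary_distance_def)
    have "p \<notin> frontier \<Omega>" using assms by (simp add: frontier_def interior_open)
    then have pos: "0 < \<rho>"
      using False \<rho> in_closed_iff_infdist_zero[of "frontier \<Omega>" p] infdist_nonneg[of p "frontier \<Omega>"]
      by (auto simp: less_le)
    moreover have "ball p \<rho> \<inter> frontier \<Omega> = {}"
      using infdist_le[of _ "frontier \<Omega>" p] \<rho> by fastforce
    then have "ball p \<rho> \<subseteq> \<Omega>"
      using connected_Int_frontier[of "ball p \<rho>" \<Omega>] pos assms(2)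
      by (metis Diff_eq_empty_iff IntI centre_in_ball connected_ball empty_iff)
    ultimately show ?thesis by simp
  qed
  then show "0 < \<rho>" "ball p \<rho> \<subseteq> \<Omega>" by auto
qed

lemma Linf_norm_le:
  assumes "open S" "continuous_on S f" "\<And>x. x \<in> S \<Longrightarrow> \<bar>f x\<bar> \<le> c"
  shows "Linf_norm S f \<le> ennreal c"
  unfolding Linf_norm_def
proof (rule esssup_I)
  \<comment> \<open>By definition \<open>esssup\<close> is \<open>top\<close> on non-measurable
    functions, so measurability has to be established first.\<close>
  have "f \<in> borel_measurable (lebesgue_on S)"
    using assms by (intro continuous_imp_measurable_on_sets_lebesgue) auto
  then show "(\<lambda>x. ennreal \<bar>f x\<bar>) \<in> borel_measurable (lebesgue_on S)" by measurable
  show "AE x in lebesgue_on S. ennreal \<bar>f x\<bar> \<le> ennreal c"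
    using assms(3) by (intro AE_I2) (auto intro: ennreal_leI)
qed

text \<open>A sausage of width \<open>r\<close> extends upwards by about \<open>r\<^sup>2\<close>,
  so a large ball admits only \<open>r\<close> of order \<open>sqrt \<rho>\<close>. This is the
  source of the exponent \<open>- 1 / 2\<close>.\<close>

lemma gradient_estimate_ball:
  assumes \<rho>: "1 \<le> \<rho>" and S: "open S" "ball p \<rho> \<subseteq> S" and u: "C2_on S u"
  shows "ennreal (norm (gradient u p)) \<le>
    ennreal 20 * (ennreal (\<rho> powr (- 1 / 2)) * Linf_norm S u +
                  ennreal (\<rho> powr (1 / 2)) * Linf_norm S (drift_laplacian u))"
proof (rule gradient_estimate[OF _ S(1) _ u, of "sqrt \<rho> / 2"])
  have "sqrt \<rho> \<le> \<rho>" using \<rho> by (simp add: real_le_lsqrt power2_eq_square)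
  then have "sqrt \<rho> / 2 + (sqrt \<rho> / 2)\<^sup>2 \<le> \<rho>" using \<rho> by (simp add: power_divide)
  then show "upward_sausage (sqrt \<rho> / 2) p \<subseteq> S"
    using upward_sausage_subset_ball S(2) by blast
qed (use \<rho> in \<open>simp_all add: powr_minus powr_half_sqrt inverse_eq_divide\<close>)

text \<open>The ball estimate is applied with \<open>S\<close> equal to all of
  \<open>\<Omega>\<close>, where the norm of \<open>drift_laplacian u\<close> is zero.\<close>

lemma harmonic_estimate_half: "harmonic_estimate (- 1 / 2) 20"
  unfolding harmonic_estimate_def
proof (intro allI impI, elim conjE)
  fix \<Omega> p \<rho> u
  assume *: "open \<Omega>" "p \<in> \<Omega>" "is_boundary_distance \<Omega> p \<rho>" "1 \<le> \<rho>" "C2_on \<Omega> u"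
    and L: "\<forall>x\<in>\<Omega>. drift_laplacian u x = 0"
  have "continuous_on \<Omega> (drift_laplacian u) \<longleftrightarrow> continuous_on \<Omega> (\<lambda>x. 0 :: real)"
    using L by (intro continuous_on_cong) auto
  then have "Linf_norm \<Omega> (drift_laplacian u) \<le> ennreal 0"
    using * L by (intro Linf_norm_le) auto
  moreover have "ennreal \<bar>pd2 u p\<bar> \<le> ennreal (norm (gradient u p))"
    using norm_fst_le[of "pd2 u p" "pd3 u p"] by (intro ennreal_leI) (simp add: gradient_def)
  ultimately show "ennreal \<bar>pd2 u p\<bar> \<le> ennreal 20 * (ennreal (\<rho> powr (- 1 / 2)) * Linf_norm \<Omega> u)"
    using gradient_estimate_ball[OF *(4,1) is_boundary_distanceD(2)[OF *(1-3)] *(5)]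
    by (simp del: ennreal_le_iff ennreal_le_iff2)
qed

section \<open>Sharpness of the exponent\<close>

lemma is_boundary_distance_lower_half_plane:
  assumes "0 < \<rho>"
  shows "is_boundary_distance {x :: real \<times> real. snd x < 0} (0, - \<rho>) \<rho>"
proof -
  have "{x :: real \<times> real. snd x < 0} = {x. (0, 1) \<bullet> x < 0}" by auto
  then have fr: "frontier {x :: real \<times> real. snd x < 0} = {x. snd x = 0}"
    using frontier_halfspace_lt[of "(0, 1) :: real \<times> real" 0] by (auto simp: zero_prod_def)
  have mem: "(0, 0) \<in> {x :: real \<times> real. snd x = 0}" by simp
  have "infdist (0, - \<rho>) {x :: real \<times> real. snd x = 0} \<le> \<rho>"
    using infdist_le[OF mem, of "(0, - \<rho>)"] assms by (simp add: dist_prod_def dist_real_def)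
  moreover have "\<rho> \<le> dist (0, - \<rho>) x" if "snd x = 0" for x :: "real \<times> real"
    using dist_snd_le[of "(0, - \<rho>)" x] that assms by (simp add: dist_real_def)
  then have "\<rho> \<le> infdist (0, - \<rho>) {x :: real \<times> real. snd x = 0}"
    using mem unfolding infdist_def by (auto intro!: cINF_greatest)
  ultimately show ?thesis using mem by (auto simp: is_boundary_distance_def fr)
qed

text \<open>Separation of variables: the exponential factor contributes \<open>a\<^sup>2 + a\<close>
  to the operator and the sine factor \<open>- k\<^sup>2\<close>.\<close>

lemma separated_L_harmonic:
  fixes a k :: real
  assumes k: "k\<^sup>2 = a\<^sup>2 + a"
  defines "u \<equiv> \<lambda>x. exp (a * snd x) * sin (k * fst x)"
  shows "C2_on S u" "drift_laplacian u x = 0" "pd2 u x = k * exp (a * snd x) * cos (k * fst x)"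
proof -
  have pd2_eq: "pd2 v = v'" if "\<And>s t. ((\<lambda>s. v (s, t)) has_real_derivative v' (s, t)) (at s)" for v v'
    using that by (force simp: pd2_def intro!: DERIV_imp_deriv)
  have pd3_eq: "pd3 v = v'" if "\<And>s t. ((\<lambda>t. v (s, t)) has_real_derivative v' (s, t)) (at t)" for v v'
    using that by (force simp: pd3_def intro!: DERIV_imp_deriv)
  \<comment> \<open>Up to scalars, \<open>u\<close> and its companion \<open>w\<close> are closed
    under both partial derivatives, so the four rules in \<open>d\<close> cover every derivative up
    to second order.\<close>
  define w where "w = (\<lambda>x :: real \<times> real. exp (a * snd x) * cos (k * fst x))"
  have d: "((\<lambda>s. u (s, t)) has_real_derivative k * w (s, t)) (at s)"
    "((\<lambda>t. u (s, t)) has_real_derivative a * u (s, t)) (at t)"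
    "((\<lambda>s. w (s, t)) has_real_derivative - k * u (s, t)) (at s)"
    "((\<lambda>t. w (s, t)) has_real_derivative a * w (s, t)) (at t)" for s t
    unfolding u_def w_def by (auto intro!: derivative_eq_intros)
  have pd: "pd2 u = (\<lambda>x. k * w x)" "pd3 u = (\<lambda>x. a * u x)"
    "pd2 (\<lambda>x. k * w x) = (\<lambda>x. k * (- k * u x))" "pd3 (\<lambda>x. k * w x) = (\<lambda>x. k * (a * w x))"
    "pd2 (\<lambda>x. a * u x) = (\<lambda>x. a * (k * w x))" "pd3 (\<lambda>x. a * u x) = (\<lambda>x. a * (a * u x))"
    by (rule pd2_eq pd3_eq, rule d DERIV_cmult[OF d(1)] DERIV_cmult[OF d(2)]
        DERIV_cmult[OF d(3)] DERIV_cmult[OF d(4)])+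
  have diff: "(\<lambda>s. u (s, t)) differentiable at s" "(\<lambda>t. u (s, t)) differentiable at t"
    "(\<lambda>s. w (s, t)) differentiable at s" "(\<lambda>t. w (s, t)) differentiable at t" for s t
    using d real_differentiable_def by blast+
  have "continuous_on S u" "continuous_on S w"
    unfolding u_def w_def by (intro continuous_intros)+
  then show "C2_on S u"
    unfolding C2_on_def C1_on_def pd by (auto intro!: continuous_intros diff differentiable_mult)
  have "drift_laplacian u x = (a\<^sup>2 + a - k\<^sup>2) * u x"
    by (simp add: drift_laplacian_def laplacian_def gradient_def e3_def pd power2_eq_square algebra_simps)
  then show "drift_laplacian u x = 0" by (simp add: k)
  show "pd2 u x = k * exp (a * snd x) * cos (k * fst x)"
    by (simp add: pd w_def)
qed

lemma harmonic_estimate_imp_powr_le: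
  assumes est: "harmonic_estimate \<alpha> C" and \<rho>: "1 \<le> \<rho>"
  shows "\<rho> powr (- 1 / 2) * exp (- 1) \<le> \<bar>C\<bar> * \<rho> powr \<alpha>"
proof -
  \<comment> \<open>At height \<open>- \<rho>\<close> the exponential factor is then
    \<open>exp (- 1)\<close> for every \<open>\<rho>\<close>, while \<open>k \<ge> sqrt a\<close> is
    of the order claimed to be optimal.\<close>
  define a where "a = 1 / \<rho>"
  define k where "k = sqrt (a\<^sup>2 + a)"
  define u where "u = (\<lambda>x. exp (a * snd x) * sin (k * fst x))"
  let ?\<Omega> = "{x :: real \<times> real. snd x < 0}"
  have a: "0 < a" using \<rho> by (simp add: a_def)
  then have k: "k\<^sup>2 = a\<^sup>2 + a" by (simp add: k_def)
  note u = separated_L_harmonic[OF k, folded u_def]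
  have "open ?\<Omega>" by (intro open_Collect_less continuous_intros)
  have "?\<Omega> = {x. (0, 1) \<bullet> x < 0}" by auto
  then have "connected ?\<Omega>" by (metis convex_connected convex_halfspace_lt)
  have bound: "\<bar>u x\<bar> \<le> 1" if "x \<in> ?\<Omega>" for x
  proof -
    have "exp (a * snd x) \<le> 1" using that a by (simp add: mult_le_0_iff)
    then show ?thesis
      using mult_mono[of "exp (a * snd x)" 1 "\<bar>sin (k * fst x)\<bar>" 1] by (simp add: u_def abs_mult)
  qed
  have "bounded (u ` ?\<Omega>)" using bound by (intro boundedI[of _ 1]) auto
  then have "ennreal \<bar>pd2 u (0, - \<rho>)\<bar> \<le> ennreal C * (ennreal (\<rho> powr \<alpha>) * Linf_norm ?\<Omega> u)"
    using est \<rho> \<open>open ?\<Omega>\<close> \<open>connected ?\<Omega>\<close> is_boundary_distance_lower_half_plane[of \<rho>] u(1,2)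
    unfolding harmonic_estimate_def by auto
  also have "\<dots> \<le> ennreal \<bar>C\<bar> * (ennreal (\<rho> powr \<alpha>) * ennreal 1)"
    using bound \<open>open ?\<Omega>\<close>
    by (intro mult_mono Linf_norm_le ennreal_leI) (auto simp: u_def intro!: continuous_intros)
  also have "\<dots> = ennreal (\<bar>C\<bar> * \<rho> powr \<alpha>)" by (simp add: ennreal_mult)
  finally have "\<bar>pd2 u (0, - \<rho>)\<bar> \<le> \<bar>C\<bar> * \<rho> powr \<alpha>" by (simp add: ennreal_le_iff)
  moreover have "pd2 u (0, - \<rho>) = k * exp (- 1)" using \<rho> by (simp add: u(3) a_def)
  moreover have "\<rho> powr (- 1 / 2) = sqrt a"
    using \<rho> by (simp add: a_def powr_minus powr_half_sqrt real_sqrt_divide inverse_eq_divide)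
  moreover have "sqrt a \<le> k" by (simp add: k_def)
  ultimately show ?thesis by (smt (verit) exp_gt_zero mult_right_mono)
qed

lemma not_harmonic_estimate:
  assumes "\<alpha> < - 1 / 2"
  shows "\<not> harmonic_estimate \<alpha> C"
proof
  assume est: "harmonic_estimate \<alpha> C"
  define \<beta> where "\<beta> = - 1 / 2 - \<alpha>"
  have \<beta>: "0 < \<beta>" using assms by (simp add: \<beta>_def)
  \<comment> \<open>The choice gives \<open>B * exp (- 1) > \<bar>C\<bar>\<close>, and
    \<open>B \<ge> 1\<close> guarantees that the solution \<open>\<rho>\<close> of
    \<open>\<rho> powr \<beta> = B\<close> is at least 1.\<close>
  define B where "B = exp 1 * \<bar>C\<bar> + 1"
  have B: "1 \<le> B" by (simp add: B_def)
  define \<rho> where "\<rho> = B powr (1 / \<beta>)"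
  have \<rho>: "1 \<le> \<rho>" using B \<beta> by (simp add: \<rho>_def ge_one_powr_ge_zero)
  have "\<rho> powr \<beta> = B" using B \<beta> by (simp add: \<rho>_def powr_powr)
  moreover have "\<rho> powr (- 1 / 2) = \<rho> powr \<beta> * \<rho> powr \<alpha>"
    by (simp add: \<beta>_def flip: powr_add)
  ultimately have "B * exp (- 1) * \<rho> powr \<alpha> \<le> \<bar>C\<bar> * \<rho> powr \<alpha>"
    using harmonic_estimate_imp_powr_le[OF est \<rho>] by (simp add: mult_ac)
  then have "B * exp (- 1) \<le> \<bar>C\<bar>" using \<rho> by simp
  then show False by (simp add: B_def exp_minus field_simps)
qed

section \<open>The gradient estimates with a common constant\<close>

text \<open>The split at \<open>\<rho> = 1\<close> reflects which sausage fits into the ball: one of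
  width \<open>sqrt \<rho> / 2\<close> at large scales, one of width \<open>\<rho> / 2\<close> at
  small scales. In the third estimate the norms are taken over the sausage, which the sausages
  property places inside \<open>\<Omega>\<close>.\<close>

theorem lemma3p7:
  shows "\<exists>K>0.
    (\<forall>p \<rho> u. 0 < \<rho> \<and> C2_on (upward_sausage \<rho> p) u \<longrightarrow>
       ennreal (norm (gradient u p)) \<le>
         ennreal K * (ennreal (1 / \<rho>) * Linf_norm (upward_sausage \<rho> p) u +
                      ennreal \<rho> * Linf_norm (upward_sausage \<rho> p) (drift_laplacian u))) \<and>
    (\<forall>\<Omega> p \<rho> u. open \<Omega> \<and> connected \<Omega> \<and> p \<in> \<Omega> \<and> is_boundary_distance \<Omega> p \<rho> \<and> C2_on \<Omega> u \<longrightarrow>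
       (1 \<le> \<rho> \<longrightarrow>
         ennreal (norm (gradient u p)) \<le>
           ennreal K * (ennreal (\<rho> powr (- 1 / 2)) * Linf_norm (ball p \<rho>) u +
                        ennreal (\<rho> powr (1 / 2)) * Linf_norm (ball p \<rho>) (drift_laplacian u))) \<and>
       (\<rho> < 1 \<longrightarrow>
         ennreal (norm (gradient u p)) \<le>
           ennreal K * (ennreal (1 / \<rho>) * Linf_norm (ball p \<rho>) u +
                        ennreal \<rho> * Linf_norm (ball p \<rho>) (drift_laplacian u)))) \<and>
    (\<forall>\<Omega> p \<rho> u. open \<Omega> \<and> connected \<Omega> \<and> upward_sausages_property \<Omega> \<and> p \<in> \<Omega> \<and>
         is_boundary_distance \<Omega> p \<rho> \<and> C2_on \<Omega> u \<longrightarrow>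
       ennreal (norm (gradient u p)) \<le>
         ennreal K * (ennreal (1 / \<rho>) * Linf_norm (upward_sausage \<rho> p) u +
                      ennreal \<rho> * Linf_norm (upward_sausage \<rho> p) (drift_laplacian u))) \<and>
    harmonic_estimate (- 1 / 2) K \<and>
    (\<forall>\<alpha> < - 1 / 2. \<nexists>C. harmonic_estimate \<alpha> C)"
proof (intro exI[of _ 20] conjI allI impI)
  show "(0 :: real) < 20" by simp
next
  fix p \<rho> u
  assume "0 < \<rho> \<and> C2_on (upward_sausage \<rho> p) u"
  then show "ennreal (norm (gradient u p)) \<le>
      ennreal 20 * (ennreal (1 / \<rho>) * Linf_norm (upward_sausage \<rho> p) u +
                    ennreal \<rho> * Linf_norm (upward_sausage \<rho> p) (drift_laplacian u))"
    by (intro gradient_estimate[OF _ open_upward_sausage]) (auto intro: divide_right_mono)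
next
  fix \<Omega> p \<rho> u
  assume *: "open \<Omega> \<and> connected \<Omega> \<and> p \<in> \<Omega> \<and> is_boundary_distance \<Omega> p \<rho> \<and> C2_on \<Omega> u" and "1 \<le> \<rho>"
  then show "ennreal (norm (gradient u p)) \<le>
      ennreal 20 * (ennreal (\<rho> powr (- 1 / 2)) * Linf_norm (ball p \<rho>) u +
                    ennreal (\<rho> powr (1 / 2)) * Linf_norm (ball p \<rho>) (drift_laplacian u))"
    using is_boundary_distanceD[of \<Omega> p \<rho>] C2_on_subset[of \<Omega> u "ball p \<rho>"]
    by (intro gradient_estimate_ball) auto
next
  fix \<Omega> p \<rho> u
  assume *: "open \<Omega> \<and> connected \<Omega> \<and> p \<in> \<Omega> \<and> is_boundary_distance \<Omega> p \<rho> \<and> C2_on \<Omega> u" and "\<rho> < 1"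
  then have \<rho>: "0 < \<rho>" "C2_on (ball p \<rho>) u"
    using is_boundary_distanceD[of \<Omega> p \<rho>] C2_on_subset[of \<Omega> u "ball p \<rho>"] by auto
  \<comment> \<open>At scales below 1 the height of the sausage is dominated by its width:
    \<open>\<rho> / 2 + \<rho>\<^sup>2 / 4\<close> is at most \<open>3 * \<rho> / 4\<close>.\<close>
  have "\<rho> * \<rho> \<le> 1 * \<rho>" using \<rho> \<open>\<rho> < 1\<close> by (intro mult_right_mono) auto
  moreover have "(\<rho> / 2)\<^sup>2 = \<rho> * \<rho> / 4" by (simp add: power2_eq_square)
  ultimately have "\<rho> / 2 + (\<rho> / 2)\<^sup>2 \<le> \<rho>" using \<rho> by linarith
  then show "ennreal (norm (gradient u p)) \<le>
      ennreal 20 * (ennreal (1 / \<rho>) * Linf_norm (ball p \<rho>) u +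
                    ennreal \<rho> * Linf_norm (ball p \<rho>) (drift_laplacian u))"
    using \<rho> by (intro gradient_estimate[of "\<rho> / 2"] upward_sausage_subset_ball) auto
next
  fix \<Omega> p \<rho> u
  assume *: "open \<Omega> \<and> connected \<Omega> \<and> upward_sausages_property \<Omega> \<and> p \<in> \<Omega> \<and>
    is_boundary_distance \<Omega> p \<rho> \<and> C2_on \<Omega> u"
  then have "0 < \<rho>" using is_boundary_distanceD[of \<Omega> p \<rho>] by auto
  moreover have "upward_sausage \<rho> p \<subseteq> \<Omega>"
  proof (cases "frontier \<Omega> = {}")
    case True
    then show ?thesis using * by (auto simp: frontier_eq_empty)
  next
    case False
    then show ?thesis using * by (auto simp: upward_sausages_property_def is_boundary_distance_def)
  qed
  ultimately show "ennreal (norm (gradient u p)) \<le>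
      ennreal 20 * (ennreal (1 / \<rho>) * Linf_norm (upward_sausage \<rho> p) u +
                    ennreal \<rho> * Linf_norm (upward_sausage \<rho> p) (drift_laplacian u))"
    using * C2_on_subset[of \<Omega> u "upward_sausage \<rho> p"]
    by (intro gradient_estimate[OF _ open_upward_sausage]) (auto intro: divide_right_mono)
next
  show "harmonic_estimate (- 1 / 2) 20" by (rule harmonic_estimate_half)
next
  fix \<alpha> :: real
  assume "\<alpha> < - 1 / 2"
  then show "\<nexists>C. harmonic_estimate \<alpha> C" using not_harmonic_estimate by blast
qed

end
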